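(* Suppose: (1) $\mathcal X\subset\mathbb R^p$ and $\mathcal Y\subset\mathbb R$ are compact and $\sup_{\mathbf{x}\in\mathcal X}\sqrt{\kappa(\mathbf{x},\mathbf{x})}=X<\infty$; (2) the local losses $\ell_i(f_i(\mathbf{x}),y)$ are convex and differentiable with respect to the first scalar argument on $\mathbb R$ for all $\mathbf{x}\in\mathcal X$, $y\in\mathcal Y$, and $|\ell_i(z,y)-\ell_i(z',y)|\le C_i|z-z'|$ for all $z,z'\in\mathbb R$ and each $y\in\mathcal Y$, with $C=\max_i C_i$; (3) for the iterates of the Greedy Projected Penalty Method described in the context, $\mathbb E[\|\tilde\nabla_f\hat\psi_c(f_t(\mathbf{x}_t),\mathbf{y}_t)\|_{\mathcal H}^2\mid\mathcal F_t]\le\sigma^2$ for all $t$. Let $f_c^*=[f^*_{c,1};\dots;f^*_{c,V}]$ be the minimizer over $\mathcal H^V$ of the penalty functional $$\psi_c(f)=\sum_{i\in\mathcal V}\Big(\mathbb E_{\mathbf{x}_i,y_i}[\ell_i(f_i(\mathbf{x}_i),y_i)]+\frac\lambda2\|f_i\|_{\mathcal H}^2+\frac c2\sum_{j\in n_i}\mathbb E_{\mathbf{x}_i}\{[f_i(\mathbf{x}_i)-f_j(\mathbf{x}_i)]^2\}\Big),$$ and let $p^*$ be the primal optimal value of the consensus-constrained problem $$\min_{\{f_i\}\subset\mathcal H}\ \sum_{i\in\mathcal V}\Big(\mathbb E_{\mathbf{x}_i,y_i}[\ell_i(f_i(\mathbf{x}_i),y_i)]+\frac\lambda2\|f_i\|_{\mathcal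 H}^2\Big)\quad\text{such that}\quad f_i=f_j,\ (i,j)\in\mathcal E.$$ Then $$\frac12\sum_{i\in\mathcal V}\sum_{j\in n_i}\mathbb E_{\mathbf{x}_i}\big\{[f^*_{c,i}(\mathbf{x}_i)-f^*_{c,j}(\mathbf{x}_i)]^2\big\}\le\frac{p^*}{c}.$$
   Context: Setting. $\mathcal G=(\mathcal V,\mathcal E)$ is a symmetric, connected, directed graph with $|\mathcal V|=V$ nodes (agents); $n_i=\{j:(i,j)\in\mathcal E\}$. $\mathcal X\subset\mathbb R^p$, $\mathcal Y\subset\mathbb R$, and $\mathcal H$ is a reproducing kernel Hilbert space of functions $\mathcal X\to\mathbb R$ with positive semidefinite kernel $\kappa$. $\mathcal H^V$ is the product Hilbert space of stacked functions $f=[f_1;\dots;f_V]$, with product norm also written $\|\cdot\|_{\mathcal H}$. For each $i\in\mathcal V$, $(\mathbf{x}_i,y_i)$ is a random pair in $\mathcal X\times\mathcal Y$; $\mathbf{x}=[\mathbf{x}_1;\dots;\mathbf{x}_V]$, $\mathbf{y}=[y_1;\dots;y_V]$; $(\mathbf{x}_t,\mathbf{y}_t)$, with components $(\mathbf{x}_{i,t},y_{i,t})$, are i.i.d. realizations of $(\mathbf{x},\mathbf{y})$. $\ell_i$ is the local loss of agent $i$ and $\ell_i'$ its derivative in the scalar first argument. $\lambda>0$ is a regularization parameter and $c>0$ a penalty parameter. The following is needed only to read hypothesis (3). Stochastic functional gradient. $\nabla_f\hat\psi_c(f_t(\mathbf{x}_t),\mathbf{y}_t)\in\mathcal H^V$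 is the stack over $i\in\mathcal V$ of $$\nabla_{f_i}\hat\psi_{i,c}(f_{i,t}(\mathbf{x}_{i,t}),y_{i,t})=\lambda f_{i,t}+\Big(\ell_i'(f_{i,t}(\mathbf{x}_{i,t}),y_{i,t})+c\sum_{j\in n_i}(f_{i,t}(\mathbf{x}_{i,t})-f_{j,t}(\mathbf{x}_{i,t}))\Big)\kappa(\mathbf{x}_{i,t},\cdot).$$ Greedy Projected Penalty Method, with step-sizes $0<\eta_t<1/\lambda$ and budgets $\epsilon_t>0$. Start with $f_{i,0}=0$ and empty dictionaries $\mathbf D_{i,0}$ for every $i$. Each $f_{i,t}$ lies in $\mathcal H_{\mathbf D_{i,t}}$, where for a finite dictionary $\mathbf D=[\mathbf d_1,\dots,\mathbf d_M]$ of points of $\mathcal X$, $\mathcal H_{\mathbf D}=\mathrm{span}\{\kappa(\mathbf d_n,\cdot)\}_{n=1}^M$. At time $t$, in parallel for all $i$: (1) set $\tilde f_{i,t+1}=f_{i,t}-\eta_t\nabla_{f_i}\hat\psi_{i,c}(f_{i,t}(\mathbf{x}_{i,t}),y_{i,t})$, represented on the dictionary $\tilde{\mathbf D}_{i,t+1}=[\mathbf D_{i,t},\mathbf{x}_{i,t}]$; (2) obtain $\mathbf D_{i,t+1}$ by kernel orthogonal matching pursuit (KOMP) with budget $\epsilon_t$: start with $\mathbf D=\tilde{\mathbf D}_{i,t+1}$; while $\mathbf D$ is nonempty, for each element $\mathbf d_j$ of $\mathbf D$ compute $\gamma_j=\min_{g\in\mathcal H_{\mathbf D\setminus\{\mathbf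 d_j\}}}\|\tilde f_{i,t+1}-g\|_{\mathcal H}$, let $j^*$ minimize $\gamma_j$; if $\gamma_{j^*}>\epsilon_t$ stop, otherwise remove $\mathbf d_{j^*}$ from $\mathbf D$ and repeat; the final $\mathbf D$ is $\mathbf D_{i,t+1}$; (3) set $f_{i,t+1}=\mathcal P_{\mathcal H_{\mathbf D_{i,t+1}}}[\tilde f_{i,t+1}]$, the orthogonal projection in $\mathcal H$. Projected stochastic gradient. $\tilde\nabla_f\hat\psi_c(f_t(\mathbf{x}_t),\mathbf{y}_t)$ is the stack over $i$ of $$\tilde\nabla_{f_i}\hat\psi_{i,c}(f_{i,t}(\mathbf{x}_{i,t}),y_{i,t})=\frac1{\eta_t}\Big(f_{i,t}-\mathcal P_{\mathcal H_{\mathbf D_{i,t+1}}}\big[f_{i,t}-\eta_t\nabla_{f_i}\hat\psi_{i,c}(f_{i,t}(\mathbf{x}_{i,t}),y_{i,t})\big]\Big).$$ Filtration. $\mathcal F_t$ is the sigma-algebra of the algorithm history before the sample $(\mathbf{x}_t,\mathbf{y}_t)$ is observed.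
   Formalization: The local losses are additionally assumed nonnegative on ℝ×𝒴; without this the claim fails, e.g. for ℓ_i ≡ −1, where f_c* = 0 makes the left side 0 while p* = −V < 0. *)

theory Defs
  imports "HOL-Probability.Probability" "HOL-Library.While_Combinator"
begin

definition psd_kernel :: "'p set \<Rightarrow> ('p \<Rightarrow> 'p \<Rightarrow> real) \<Rightarrow> bool" where
  "psd_kernel X \<kappa> \<longleftrightarrow>
     (\<forall>x\<in>X. \<forall>z\<in>X. \<kappa> x z = \<kappa> z x) \<and>
     (\<forall>S a. finite S \<and> S \<subseteq> X \<longrightarrow> 0 \<le> (\<Sum>x\<in>S. \<Sum>z\<in>S. a x * a z * \<kappa> x z))"

(* A Hilbert space of functions X -> real is a Hilbert space type 'h with an evaluation map eval_at
   that is injective on X (distinct elements are distinct functions on X).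
   The element \<phi> x is the kernel section \<kappa>(x, _).  The last conjunct is the reproducing
   property; it also forces eval_at to be linear in its first argument. *)
definition rkhs ::
  "'p set \<Rightarrow> ('p \<Rightarrow> 'p \<Rightarrow> real) \<Rightarrow> ('h::{real_inner, complete_space} \<Rightarrow> 'p \<Rightarrow> real) \<Rightarrow> ('p \<Rightarrow> 'h) \<Rightarrow> bool"
where
  "rkhs X \<kappa> eval_at \<phi> \<longleftrightarrow>
     (\<forall>f g. (\<forall>x\<in>X. eval_at f x = eval_at g x) \<longrightarrow> f = g) \<and>
     (\<forall>x\<in>X. \<forall>z\<in>X. eval_at (\<phi> x) z = \<kappa> x z) \<and>
     (\<forall>f. \<forall>x\<in>X. eval_at f x = f \<bullet> \<phi> x)"

definition nbrs :: "('v \<times> 'v) set \<Rightarrow> 'v \<Rightarrow> 'v set" where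
  "nbrs E i = {j. (i, j) \<in> E}"

(* Stacked functions are vectors 'h ^ 'v; the library norm of this type is the product norm. *)

definition regularized_risk ::
  "'a measure \<Rightarrow> ('h::real_inner \<Rightarrow> 'p \<Rightarrow> real) \<Rightarrow> ('v::finite \<Rightarrow> real \<Rightarrow> real \<Rightarrow> real) \<Rightarrow> real \<Rightarrow>
   ('a \<Rightarrow> 'p ^ 'v) \<Rightarrow> ('a \<Rightarrow> real ^ 'v) \<Rightarrow> 'h ^ 'v \<Rightarrow> real"
where
  "regularized_risk M eval_at loss lam x y f =
     (\<Sum>i\<in>UNIV. (\<integral>\<omega>. loss i (eval_at (f $ i) (x \<omega> $ i)) (y \<omega> $ i) \<partial>M) + lam / 2 * (norm (f $ i))\<^sup>2)"

definition penalty_functional ::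
  "'a measure \<Rightarrow> ('v \<times> 'v) set \<Rightarrow> ('h::real_inner \<Rightarrow> 'p \<Rightarrow> real) \<Rightarrow>
   ('v::finite \<Rightarrow> real \<Rightarrow> real \<Rightarrow> real) \<Rightarrow> real \<Rightarrow> real \<Rightarrow>
   ('a \<Rightarrow> 'p ^ 'v) \<Rightarrow> ('a \<Rightarrow> real ^ 'v) \<Rightarrow> 'h ^ 'v \<Rightarrow> real"
where
  "penalty_functional M E eval_at loss lam c x y f =
     (\<Sum>i\<in>UNIV. (\<integral>\<omega>. loss i (eval_at (f $ i) (x \<omega> $ i)) (y \<omega> $ i) \<partial>M) + lam / 2 * (norm (f $ i))\<^sup>2
        + c / 2 * (\<Sum>j\<in>nbrs E i. \<integral>\<omega>. (eval_at (f $ i) (x \<omega> $ i) - eval_at (f $ j) (x \<omega> $ i))\<^sup>2 \<partial>M))"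

definition primal_value ::
  "'a measure \<Rightarrow> ('v \<times> 'v) set \<Rightarrow> ('h::real_inner \<Rightarrow> 'p \<Rightarrow> real) \<Rightarrow>
   ('v::finite \<Rightarrow> real \<Rightarrow> real \<Rightarrow> real) \<Rightarrow> real \<Rightarrow> ('a \<Rightarrow> 'p ^ 'v) \<Rightarrow> ('a \<Rightarrow> real ^ 'v) \<Rightarrow> real"
where
  "primal_value M E eval_at loss lam x y =
     Inf (regularized_risk M eval_at loss lam x y ` {f. \<forall>(i, j)\<in>E. f $ i = f $ j})"

definition dict_space :: "('p \<Rightarrow> 'h::real_inner) \<Rightarrow> 'p list \<Rightarrow> 'h set" where
  "dict_space \<phi> D = span (\<phi> ` set D)"

definition orth_proj :: "'h::real_inner set \<Rightarrow> 'h \<Rightarrow> 'h" where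
  "orth_proj S f = (THE g. g \<in> S \<and> (\<forall>h\<in>S. (f - g) \<bullet> h = 0))"

(* Dictionaries are lists, so a point that occurs twice is removed one occurrence at a time. *)
definition remove_nth :: "nat \<Rightarrow> 'p list \<Rightarrow> 'p list" where
  "remove_nth j D = take j D @ drop (Suc j) D"

definition removal_error :: "('p \<Rightarrow> 'h::real_inner) \<Rightarrow> 'h \<Rightarrow> 'p list \<Rightarrow> nat \<Rightarrow> real" where
  "removal_error \<phi> f D j = infdist f (dict_space \<phi> (remove_nth j D))"

(* The map pick breaks ties: it selects one index from the set of all minimizing indices. *)
definition best_index ::
  "('p \<Rightarrow> 'h::real_inner) \<Rightarrow> (nat set \<Rightarrow> nat) \<Rightarrow> 'h \<Rightarrow> 'p list \<Rightarrow> nat"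
where
  "best_index \<phi> pick f D = pick {j. is_arg_min (removal_error \<phi> f D) (\<lambda>j. j < length D) j}"

definition komp ::
  "('p \<Rightarrow> 'h::real_inner) \<Rightarrow> (nat set \<Rightarrow> nat) \<Rightarrow> 'h \<Rightarrow> real \<Rightarrow> 'p list \<Rightarrow> 'p list"
where
  "komp \<phi> pick f \<epsilon> D0 =
     while (\<lambda>D. D \<noteq> [] \<and> removal_error \<phi> f D (best_index \<phi> pick f D) \<le> \<epsilon>)
           (\<lambda>D. remove_nth (best_index \<phi> pick f D) D) D0"

definition stoch_grad ::
  "('v \<times> 'v) set \<Rightarrow> ('h::real_inner \<Rightarrow> 'p \<Rightarrow> real) \<Rightarrow> ('p \<Rightarrow> 'h) \<Rightarrow>
   ('v::finite \<Rightarrow> real \<Rightarrow> real \<Rightarrow> real) \<Rightarrow> real \<Rightarrow> real \<Rightarrow>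
   'h ^ 'v \<Rightarrow> 'p ^ 'v \<Rightarrow> real ^ 'v \<Rightarrow> 'h ^ 'v"
where
  "stoch_grad E eval_at \<phi> loss lam c f x y =
     (\<chi> i. lam *\<^sub>R (f $ i) +
        (deriv (\<lambda>z. loss i z (y $ i)) (eval_at (f $ i) (x $ i))
          + c * (\<Sum>j\<in>nbrs E i. eval_at (f $ i) (x $ i) - eval_at (f $ j) (x $ i))) *\<^sub>R \<phi> (x $ i))"

definition next_dict ::
  "('v \<times> 'v) set \<Rightarrow> ('h::real_inner \<Rightarrow> 'p \<Rightarrow> real) \<Rightarrow> ('p \<Rightarrow> 'h) \<Rightarrow>
   ('v::finite \<Rightarrow> real \<Rightarrow> real \<Rightarrow> real) \<Rightarrow> real \<Rightarrow> real \<Rightarrow> (nat set \<Rightarrow> nat) \<Rightarrow> real \<Rightarrow> real \<Rightarrow>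
   'h ^ 'v \<Rightarrow> ('v \<Rightarrow> 'p list) \<Rightarrow> 'p ^ 'v \<Rightarrow> real ^ 'v \<Rightarrow> 'v \<Rightarrow> 'p list"
where
  "next_dict E eval_at \<phi> loss lam c pick \<eta> \<epsilon> f D x y i =
     komp \<phi> pick ((f - \<eta> *\<^sub>R stoch_grad E eval_at \<phi> loss lam c f x y) $ i) \<epsilon> (D i @ [x $ i])"

definition next_iterate ::
  "('v \<times> 'v) set \<Rightarrow> ('h::real_inner \<Rightarrow> 'p \<Rightarrow> real) \<Rightarrow> ('p \<Rightarrow> 'h) \<Rightarrow>
   ('v::finite \<Rightarrow> real \<Rightarrow> real \<Rightarrow> real) \<Rightarrow> real \<Rightarrow> real \<Rightarrow> (nat set \<Rightarrow> nat) \<Rightarrow> real \<Rightarrow> real \<Rightarrow>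
   'h ^ 'v \<Rightarrow> ('v \<Rightarrow> 'p list) \<Rightarrow> 'p ^ 'v \<Rightarrow> real ^ 'v \<Rightarrow> 'h ^ 'v"
where
  "next_iterate E eval_at \<phi> loss lam c pick \<eta> \<epsilon> f D x y =
     (\<chi> i. orth_proj (dict_space \<phi> (next_dict E eval_at \<phi> loss lam c pick \<eta> \<epsilon> f D x y i))
             ((f - \<eta> *\<^sub>R stoch_grad E eval_at \<phi> loss lam c f x y) $ i))"

(* State of the Greedy Projected Penalty Method: current stack and dictionaries, as a function of
   the realized sample sequences xs, ys. *)
primrec gppm ::
  "('v \<times> 'v) set \<Rightarrow> ('h::real_inner \<Rightarrow> 'p \<Rightarrow> real) \<Rightarrow> ('p \<Rightarrow> 'h) \<Rightarrow>
   ('v::finite \<Rightarrow> real \<Rightarrow> real \<Rightarrow> real) \<Rightarrow> real \<Rightarrow> real \<Rightarrow> (nat set \<Rightarrow> nat) \<Rightarrow>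
   (nat \<Rightarrow> real) \<Rightarrow> (nat \<Rightarrow> real) \<Rightarrow> (nat \<Rightarrow> 'p ^ 'v) \<Rightarrow> (nat \<Rightarrow> real ^ 'v) \<Rightarrow> nat \<Rightarrow>
   ('h ^ 'v) \<times> ('v \<Rightarrow> 'p list)"
where
  "gppm E eval_at \<phi> loss lam c pick \<eta> \<epsilon> xs ys 0 = (0, \<lambda>_. [])"
| "gppm E eval_at \<phi> loss lam c pick \<eta> \<epsilon> xs ys (Suc t) =
     (case gppm E eval_at \<phi> loss lam c pick \<eta> \<epsilon> xs ys t of (f, D) \<Rightarrow>
       (next_iterate E eval_at \<phi> loss lam c pick (\<eta> t) (\<epsilon> t) f D (xs t) (ys t),
        next_dict E eval_at \<phi> loss lam c pick (\<eta> t) (\<epsilon> t) f D (xs t) (ys t)))"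

definition proj_stoch_grad ::
  "('v \<times> 'v) set \<Rightarrow> ('h::real_inner \<Rightarrow> 'p \<Rightarrow> real) \<Rightarrow> ('p \<Rightarrow> 'h) \<Rightarrow>
   ('v::finite \<Rightarrow> real \<Rightarrow> real \<Rightarrow> real) \<Rightarrow> real \<Rightarrow> real \<Rightarrow> (nat set \<Rightarrow> nat) \<Rightarrow>
   (nat \<Rightarrow> real) \<Rightarrow> (nat \<Rightarrow> real) \<Rightarrow> (nat \<Rightarrow> 'p ^ 'v) \<Rightarrow> (nat \<Rightarrow> real ^ 'v) \<Rightarrow> nat \<Rightarrow> 'h ^ 'v"
where
  "proj_stoch_grad E eval_at \<phi> loss lam c pick \<eta> \<epsilon> xs ys t =
     (let f = fst (gppm E eval_at \<phi> loss lam c pick \<eta> \<epsilon> xs ys t);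
          D' = snd (gppm E eval_at \<phi> loss lam c pick \<eta> \<epsilon> xs ys (Suc t))
      in \<chi> i. (1 / \<eta> t) *\<^sub>R
           (f $ i - orth_proj (dict_space \<phi> (D' i))
                      (f $ i - \<eta> t *\<^sub>R (stoch_grad E eval_at \<phi> loss lam c f (xs t) (ys t) $ i))))"

(* Sigma-algebra generated by the samples at times s < t.  The state of the algorithm at time t is
   a function of these samples, so this is the history before sample t is observed. *)
definition sample_history ::
  "'a measure \<Rightarrow> (nat \<Rightarrow> 'a \<Rightarrow> 'b::topological_space) \<Rightarrow> (nat \<Rightarrow> 'a \<Rightarrow> 'c::topological_space) \<Rightarrow>
   nat \<Rightarrow> 'a measure"
where
  "sample_history M xs ys t =
     sigma (space M)
       (\<Union>s\<in>{..<t}. {(\<lambda>\<omega>. (xs s \<omega>, ys s \<omega>)) -` A \<inter> space M | A. A \<in> sets borel})"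

end

theory Submission
  imports Defs
begin

text \<open>
  The argument is the standard one for exterior penalties. The penalty functional is the regularized
  risk plus \<open>c\<close> times the consensus violation (half the sum of the mean squared disagreements across
  edges). A stack that satisfies the consensus constraint has violation zero, so on the feasible set
  the two functionals agree, and comparing the penalty minimizer with a feasible stack \<open>f\<close> gives

  \<open>risk fc + c * violation fc \<le> risk f\<close>.

  Nonnegative losses make the risk of the minimizer nonnegative, so \<open>c * violation fc\<close> is a lower
  bound for the risk on the whole feasible set, hence for its infimum \<open>p\<^sup>*\<close>.
\<close>

definition consensus_violation ::
  "'a measure \<Rightarrow> ('v \<times> 'v) set \<Rightarrow> ('h::real_inner \<Rightarrow> 'p \<Rightarrow> real) \<Rightarrow>
   ('a \<Rightarrow> 'p ^ 'v) \<Rightarrow> 'h ^ 'v::finite \<Rightarrow> real"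
where
  "consensus_violation M E eval_at x f =
     1 / 2 * (\<Sum>i\<in>UNIV. \<Sum>j\<in>nbrs E i.
       \<integral>\<omega>. (eval_at (f $ i) (x \<omega> $ i) - eval_at (f $ j) (x \<omega> $ i))\<^sup>2 \<partial>M)"

lemma penalty_functional_eq_risk_plus_violation:
  "penalty_functional M E eval_at loss lam c x y f =
     regularized_risk M eval_at loss lam x y f + c * consensus_violation M E eval_at x f"
  by (simp add: penalty_functional_def regularized_risk_def consensus_violation_def
      sum.distrib sum_distrib_left)

lemma consensus_violation_feasible_eq_0:
  assumes "\<forall>(i, j)\<in>E. f $ i = f $ j"
  shows "consensus_violation M E eval_at x f = 0"
proof -
  have "f $ j = f $ i" if "j \<in> nbrs E i" for i j
    using assms that by (fastforce simp: nbrs_def)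
  then show ?thesis
    by (simp add: consensus_violation_def)
qed

lemma regularized_risk_nonneg:
  assumes "lam \<ge> 0"
    and "\<And>i z \<omega>. \<omega> \<in> space M \<Longrightarrow> 0 \<le> loss i z (y \<omega> $ i)"
  shows "0 \<le> regularized_risk M eval_at loss lam x y f"
  unfolding regularized_risk_def
  using assms by (intro sum_nonneg add_nonneg_nonneg Bochner_Integration.integral_nonneg) auto

theorem proposition2:
  fixes M :: "'a measure"
    and E :: "('v::finite \<times> 'v) set"
    and X :: "(real ^ 'p) set" and Y :: "real set"
    and \<kappa> :: "real ^ 'p \<Rightarrow> real ^ 'p \<Rightarrow> real"
    and eval_at :: "'h::{real_inner, complete_space} \<Rightarrow> real ^ 'p \<Rightarrow> real"
    and \<phi> :: "real ^ 'p \<Rightarrow> 'h"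
    and loss :: "'v \<Rightarrow> real \<Rightarrow> real \<Rightarrow> real"
    and x :: "'a \<Rightarrow> real ^ 'p ^ 'v" and y :: "'a \<Rightarrow> real ^ 'v"
    and xs :: "nat \<Rightarrow> 'a \<Rightarrow> real ^ 'p ^ 'v" and ys :: "nat \<Rightarrow> 'a \<Rightarrow> real ^ 'v"
    and \<eta> \<epsilon> :: "nat \<Rightarrow> real"
    and pick :: "nat set \<Rightarrow> nat"
    and Lip :: "'v \<Rightarrow> real"
    and lam c Xmax C \<sigma> :: real
    and fc :: "'h ^ 'v"
  assumes graph: "sym E" "\<And>i j. (i, j) \<in> E\<^sup>*"
    and kernel: "psd_kernel X \<kappa>" "rkhs X \<kappa> eval_at \<phi>"
    and parameters: "lam > 0" "c > 0"
    and prob: "prob_space M"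
    and random_pair: "x \<in> borel_measurable M" "y \<in> borel_measurable M"
      "\<And>\<omega> i. \<omega> \<in> space M \<Longrightarrow> x \<omega> $ i \<in> X \<and> y \<omega> $ i \<in> Y"
    and samples_range: "\<And>t \<omega> i. \<omega> \<in> space M \<Longrightarrow> xs t \<omega> $ i \<in> X \<and> ys t \<omega> $ i \<in> Y"
    and samples_indep: "prob_space.indep_vars M (\<lambda>_. borel) (\<lambda>t \<omega>. (xs t \<omega>, ys t \<omega>)) UNIV"
    and samples_law: "\<And>t. distr M borel (\<lambda>\<omega>. (xs t \<omega>, ys t \<omega>)) = distr M borel (\<lambda>\<omega>. (x \<omega>, y \<omega>))"
    and measurable_kernel:
      "(\<lambda>(u, v). \<kappa> u v) \<in> borel_measurable (restrict_space borel (X \<times> X))"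
    and measurable_loss: "\<And>i z. loss i z \<in> borel_measurable (restrict_space borel Y)"
    and finite_risk: "\<And>i f. integrable M (\<lambda>\<omega>. loss i (eval_at f (x \<omega> $ i)) (y \<omega> $ i))"
    and loss_nonneg: "\<And>i z u. u \<in> Y \<Longrightarrow> 0 \<le> loss i z u"
    and compact_domains: "compact X" "compact Y"
    and bounded_kernel: "bdd_above ((\<lambda>u. sqrt (\<kappa> u u)) ` X)" "(SUP u\<in>X. sqrt (\<kappa> u u)) = Xmax"
    and loss_convex: "\<And>i u. u \<in> Y \<Longrightarrow> convex_on UNIV (\<lambda>z. loss i z u)"
    and loss_differentiable: "\<And>i u z. u \<in> Y \<Longrightarrow> (\<lambda>z. loss i z u) differentiable (at z)"
    and loss_Lipschitz: "\<And>i u z z'. u \<in> Y \<Longrightarrow> \<bar>loss i z u - loss i z' u\<bar> \<le> Lip i * \<bar>z - z'\<bar>"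
      "C = Max (range Lip)"
    and step_sizes: "\<And>t. 0 < \<eta> t \<and> \<eta> t < 1 / lam"
    and budgets: "\<And>t. 0 < \<epsilon> t"
    and tie_breaking: "\<And>J. finite J \<Longrightarrow> J \<noteq> {} \<Longrightarrow> pick J \<in> J"
    and bounded_second_moment:
      "\<And>t. AE \<omega> in M. nn_cond_exp M (sample_history M xs ys t)
          (\<lambda>\<omega>. ennreal ((norm (proj_stoch_grad E eval_at \<phi> loss lam c pick \<eta> \<epsilon>
                                 (\<lambda>s. xs s \<omega>) (\<lambda>s. ys s \<omega>) t))\<^sup>2)) \<omega> \<le> ennreal (\<sigma>\<^sup>2)"
    and minimizer: "is_arg_min (penalty_functional M E eval_at loss lam c x y) (\<lambda>_. True) fc"
  shows "1 / 2 * (\<Sum>i\<in>UNIV. \<Sum>j\<in>nbrs E i.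
            \<integral>\<omega>. (eval_at (fc $ i) (x \<omega> $ i) - eval_at (fc $ j) (x \<omega> $ i))\<^sup>2 \<partial>M)
         \<le> primal_value M E eval_at loss lam x y / c"
proof -
  let ?R = "regularized_risk M eval_at loss lam x y"
  let ?V = "consensus_violation M E eval_at x"
  have "c * ?V fc \<le> ?R f" if feasible: "\<forall>(i, j)\<in>E. f $ i = f $ j" for f
  proof -
    have "0 \<le> ?R fc"
      using parameters(1) loss_nonneg random_pair(3) by (intro regularized_risk_nonneg) auto
    moreover have "?R fc + c * ?V fc \<le> ?R f + c * ?V f"
      using minimizer
      by (simp add: is_arg_min_linorder flip: penalty_functional_eq_risk_plus_violation)
    ultimately show ?thesis
      using consensus_violation_feasible_eq_0[OF feasible, of M eval_at x] by simp
  qed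
  \<comment> \<open>The zero stack is feasible, so the infimum is over a nonempty set.\<close>
  moreover have "(0 :: 'h ^ 'v) \<in> {f. \<forall>(i, j)\<in>E. f $ i = f $ j}"
    by auto
  ultimately have "c * ?V fc \<le> primal_value M E eval_at loss lam x y"
    unfolding primal_value_def by (intro cInf_greatest) blast+
  then show ?thesis
    using parameters(2)
    by (simp add: pos_le_divide_eq mult.commute consensus_violation_def)
qed

end
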